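(* Let $\mathbf{S}$ be a completely simple semigroup. Let $\rho$ and $\sigma_k$, $k\in K$ ($K$ an index set), be congruences on $\mathbf{S}$. Then $[\rho,\bigvee_{k\in K}\sigma_k]=\bigvee_{k\in K}[\rho,\sigma_k]$.
   Context: A completely simple semigroup is a simple semigroup (no proper ideals) containing a primitive idempotent, i.e. an element $e$ such that $x=e$ is the unique solution of $ex=xe=x=x^2$. $\mathbb{N}=\{1,2,\dots\}$. For an algebra $\mathbf{A}$ and congruences $\alpha,\beta,\delta$ of $\mathbf{A}$, $C(\alpha,\beta;\delta)$ means: for all $n\in\mathbb{N}$, all $(n+1)$-ary term functions $t$ of $\mathbf{A}$, all $a,b\in A$ and $\mathbf{c},\mathbf{d}\in A^n$ with $a\,\alpha\,b$ and $c_i\,\beta\,d_i$ for every $i$, $t(a,\mathbf{c})\,\delta\,t(a,\mathbf{d})$ implies $t(b,\mathbf{c})\,\delta\,t(b,\mathbf{d})$. The commutator $[\alpha,\beta]$ is the least congruence $\delta$ with $C(\alpha,\beta;\delta)$. Semigroups are algebras with one binary operation. Joins are taken in the congruence lattice of $\mathbf{S}$. *)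

theory Defs
  imports Main
begin

section \<open>Completely simple semigroups\<close>

context semigroup_mult
begin

definition is_ideal :: "'a set \<Rightarrow> bool" where
  "is_ideal I \<longleftrightarrow> I \<noteq> {} \<and> (\<forall>s. \<forall>x\<in>I. s * x \<in> I \<and> x * s \<in> I)"

text \<open>The equivalence read from right to left says in particular that \<open>e\<close> is idempotent.\<close>

definition primitive_idempotent :: "'a \<Rightarrow> bool" where
  "primitive_idempotent e \<longleftrightarrow> (\<forall>x. (e * x = x \<and> x * e = x \<and> x = x * x) \<longleftrightarrow> x = e)"

end

class completely_simple_semigroup = semigroup_mult +
  assumes simple: "is_ideal I \<Longrightarrow> I = UNIV"
    and ex_primitive_idempotent: "\<exists>e. primitive_idempotent e"


section \<open>Congruences and their joins\<close>

definition congruence :: "('a::semigroup_mult \<times> 'a) set \<Rightarrow> bool" where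
  "congruence r \<longleftrightarrow> equiv UNIV r \<and>
     (\<forall>a b c d. (a, b) \<in> r \<longrightarrow> (c, d) \<in> r \<longrightarrow> (a * c, b * d) \<in> r)"

text \<open>The supremum of a family in the lattice of congruences; for the empty family it is
  the equality relation.\<close>

definition cong_join :: "('a::semigroup_mult \<times> 'a) set set \<Rightarrow> ('a \<times> 'a) set" where
  "cong_join R = (LEAST \<theta>. congruence \<theta> \<and> (\<forall>r\<in>R. r \<subseteq> \<theta>))"


section \<open>Term functions, the term condition and the commutator\<close>

datatype sg_term = Var nat | Mult sg_term sg_term

primrec term_vars :: "sg_term \<Rightarrow> nat set" where
  "term_vars (Var i) = {i}"
| "term_vars (Mult s t) = term_vars s \<union> term_vars t"

primrec term_eval :: "sg_term \<Rightarrow> 'a::semigroup_mult list \<Rightarrow> 'a" where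
  "term_eval (Var i) xs = xs ! i"
| "term_eval (Mult s t) xs = term_eval s xs * term_eval t xs"

text \<open>The \<open>m\<close>-ary term functions are the maps \<open>term_eval t\<close>, restricted to lists of length
  \<open>m\<close>, for terms \<open>t\<close> whose variables have indices below \<open>m\<close>.\<close>

definition centralizes ::
  "('a::semigroup_mult \<times> 'a) set \<Rightarrow> ('a \<times> 'a) set \<Rightarrow> ('a \<times> 'a) set \<Rightarrow> bool" where
  "centralizes \<alpha> \<beta> \<delta> \<longleftrightarrow>
     (\<forall>n\<ge>1. \<forall>t. term_vars t \<subseteq> {..<n + 1} \<longrightarrow>
       (\<forall>a b cs ds. length cs = n \<longrightarrow> length ds = n \<longrightarrow>
          (a, b) \<in> \<alpha> \<longrightarrow> (\<forall>i<n. (cs ! i, ds ! i) \<in> \<beta>) \<longrightarrow>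
          (term_eval t (a # cs), term_eval t (a # ds)) \<in> \<delta> \<longrightarrow>
          (term_eval t (b # cs), term_eval t (b # ds)) \<in> \<delta>))"

definition commutator ::
  "('a::semigroup_mult \<times> 'a) set \<Rightarrow> ('a \<times> 'a) set \<Rightarrow> ('a \<times> 'a) set" where
  "commutator \<alpha> \<beta> = (LEAST \<delta>. congruence \<delta> \<and> centralizes \<alpha> \<beta> \<delta>)"


section \<open>The least congruences above exist\<close>

lemma congruence_Inter:
  assumes "\<And>r. r \<in> R \<Longrightarrow> congruence r"
  shows "congruence (\<Inter>R)"
proof -
  have "equiv UNIV (\<Inter>R)"
  proof (rule equivI)
    show "refl_on UNIV (\<Inter>R)"
      using assms unfolding congruence_def equiv_def refl_on_def by blast
    show "sym (\<Inter>R)"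
      using assms unfolding congruence_def equiv_def by (intro symI) (meson InterE InterI symD)
    show "trans (\<Inter>R)"
      using assms unfolding congruence_def equiv_def by (intro transI) (meson InterE InterI transD)
  qed auto
  moreover have "(a * c, b * d) \<in> \<Inter>R" if "(a, b) \<in> \<Inter>R" "(c, d) \<in> \<Inter>R" for a b c d
    using that assms unfolding congruence_def by (meson InterE InterI)
  ultimately show ?thesis
    unfolding congruence_def by blast
qed

lemma centralizes_Inter:
  assumes "\<And>\<delta>. \<delta> \<in> D \<Longrightarrow> centralizes \<alpha> \<beta> \<delta>"
  shows "centralizes \<alpha> \<beta> (\<Inter>D)"
  unfolding centralizes_def
proof (intro allI impI InterI)
  fix n t a b cs ds \<delta>
  assume "n \<ge> 1" "term_vars t \<subseteq> {..<n + 1}" "length cs = n" "length ds = n" "(a, b) \<in> \<alpha>"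
    "\<forall>i<n. (cs ! i, ds ! i) \<in> \<beta>" "(term_eval t (a # cs), term_eval t (a # ds)) \<in> \<Inter>D" "\<delta> \<in> D"
  moreover from this have "(term_eval t (a # cs), term_eval t (a # ds)) \<in> \<delta>"
    by blast
  ultimately show "(term_eval t (b # cs), term_eval t (b # ds)) \<in> \<delta>"
    using assms[OF \<open>\<delta> \<in> D\<close>, unfolded centralizes_def, rule_format, of n t cs ds a b] by simp
qed

lemma Least_eq_Inter:
  fixes P :: "'a set \<Rightarrow> bool"
  assumes "P (\<Inter>{x. P x})"
  shows "(LEAST x. P x) = \<Inter>{x. P x}"
  using assms by (intro Least_equality) auto

lemma cong_join_eq_Inter: "cong_join R = \<Inter>{\<theta>. congruence \<theta> \<and> (\<forall>r\<in>R. r \<subseteq> \<theta>)}"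
  unfolding cong_join_def
  by (rule Least_eq_Inter) (auto intro!: congruence_Inter)

lemma commutator_eq_Inter: "commutator \<alpha> \<beta> = \<Inter>{\<delta>. congruence \<delta> \<and> centralizes \<alpha> \<beta> \<delta>}"
  unfolding commutator_def
  by (rule Least_eq_Inter) (auto intro!: congruence_Inter centralizes_Inter)

lemma congruence_cong_join: "congruence (cong_join R)"
  unfolding cong_join_eq_Inter by (rule congruence_Inter) auto

lemma congruence_commutator: "congruence (commutator \<alpha> \<beta>)"
  unfolding commutator_eq_Inter by (rule congruence_Inter) auto

lemma centralizes_commutator: "centralizes \<alpha> \<beta> (commutator \<alpha> \<beta>)"
  unfolding commutator_eq_Inter by (rule centralizes_Inter) auto

end

theory Submission
  imports Defs
begin

text \<open>
  One inclusion holds because \<open>centralizes \<alpha> \<beta> \<delta>\<close> is antitone in \<open>\<beta>\<close>. For the other, put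
  \<open>\<delta> = \<Or>[\<rho>, \<sigma>\<^sub>k]\<close>. What has to be shown is \<open>centralizes \<rho> (\<Or>\<sigma>\<^sub>k) \<delta>\<close>, and two things are in the way.
  Enlarging \<open>[\<rho>, \<sigma>\<^sub>k]\<close> to \<open>\<delta>\<close> weakens the premise of the term condition along with its conclusion.
  And on a chain \<open>c, c', c'', \<dots>, d\<close> of \<open>\<sigma>\<^sub>k\<close>-steps with varying \<open>k\<close> the premise relates only the
  values at the two ends, so that nothing can be inferred about a single step.

  Both obstacles disappear if the implication is replaced by an identity between differences.
  Let \<open>e\<close> be a primitive idempotent. Then \<open>eSe\<close> is a group; write \<open>\<iota>(x)\<close> for the inverse of \<open>exe\<close>
  in it. Say that \<open>\<delta>\<close> satisfies the difference condition if
    \<open>\<iota>(t(a,c)) t(b,c) e  \<delta>  \<iota>(t(a,d)) t(b,d) e\<close>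
  for all terms \<open>t\<close>, whenever \<open>a \<alpha> b\<close> and \<open>c \<beta> d\<close>; that is, the quotient of the values at \<open>a\<close> and
  at \<open>b\<close>, computed in \<open>eSe\<close>, does not depend on the parameters modulo \<open>\<delta>\<close>. This condition is
  visibly monotone in \<open>\<delta>\<close> and transitive in the parameters, so it passes to joins of the \<open>\<beta>\<close>s.

  It is also equivalent to the term condition. Given the term condition, apply it to the
  term \<open>v \<cdot> t(x,y) \<cdot> e\<close>, where the parameter \<open>v\<close> takes the \<open>\<beta>\<close>-related values \<open>\<iota>(t(a,c))\<close> and
  \<open>\<iota>(t(a,d))\<close>: at \<open>x = a\<close> both sides equal \<open>e\<close>, and at \<open>x = b\<close> the conclusion is the difference
  condition (lemma \<open>difference_condition_if_centralizes\<close>). Conversely, if \<open>t(a,c) \<delta> t(a,d)\<close>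
  then the difference condition gives \<open>e t(b,c) e \<delta> e t(b,d) e\<close>, and both factors \<open>e\<close> can be
  cancelled. Indeed, modulo \<open>\<delta>\<close> the elements \<open>t(b,c)\<close> and \<open>t(b,d)\<close> lie in the same R-class: this is
  the R-class of their first letter, which is either \<open>b\<close> on both sides or a parameter, and in
  the latter case the hypothesis \<open>t(a,c) \<delta> t(a,d)\<close> puts both values of that parameter
  into one R-class. Dually for last letters and L-classes
  (lemma \<open>centralizes_if_difference_condition\<close>).
\<close>

section \<open>Congruences, joins and the commutator in arbitrary semigroups\<close>

lemma
  assumes "congruence \<theta>"
  shows cong_refl: "(x, x) \<in> \<theta>"
    and cong_sym: "(x, y) \<in> \<theta> \<Longrightarrow> (y, x) \<in> \<theta>"
    and cong_trans: "(x, y) \<in> \<theta> \<Longrightarrow> (y, z) \<in> \<theta> \<Longrightarrow> (x, z) \<in> \<theta>"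
    and cong_mult: "(x, y) \<in> \<theta> \<Longrightarrow> (x', y') \<in> \<theta> \<Longrightarrow> (x * x', y * y') \<in> \<theta>"
  using assms unfolding congruence_def equiv_def by (auto dest: refl_onD symD transD)

lemma cong_join_upper: "r \<in> R \<Longrightarrow> r \<subseteq> cong_join R"
  unfolding cong_join_eq_Inter by blast

lemma cong_join_least: "congruence \<theta> \<Longrightarrow> (\<And>r. r \<in> R \<Longrightarrow> r \<subseteq> \<theta>) \<Longrightarrow> cong_join R \<subseteq> \<theta>"
  unfolding cong_join_eq_Inter by blast

lemma commutator_least: "congruence \<delta> \<Longrightarrow> centralizes \<alpha> \<beta> \<delta> \<Longrightarrow> commutator \<alpha> \<beta> \<subseteq> \<delta>"
  unfolding commutator_eq_Inter by blast

lemma centralizes_antimono: "centralizes \<alpha> \<beta> \<delta> \<Longrightarrow> \<beta>' \<subseteq> \<beta> \<Longrightarrow> centralizes \<alpha> \<beta>' \<delta>"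
  unfolding centralizes_def by (simp add: subset_iff)

lemma commutator_mono: "\<beta>' \<subseteq> \<beta> \<Longrightarrow> commutator \<alpha> \<beta>' \<subseteq> commutator \<alpha> \<beta>"
  by (rule commutator_least[OF congruence_commutator
        centralizes_antimono[OF centralizes_commutator]])

lemma cong_join_subset_rtrancl:
  fixes R :: "('a::semigroup_mult \<times> 'a) set set"
  assumes R: "\<And>r. r \<in> R \<Longrightarrow> congruence r"
  shows "cong_join R \<subseteq> (\<Union>R)\<^sup>*"
proof (rule cong_join_least)
  have left: "(s * x, s * y) \<in> (\<Union>R)\<^sup>*" if "(x, y) \<in> (\<Union>R)\<^sup>*" for s x y
    using that
  proof induction
    case (step y z)
    then have "(s * y, s * z) \<in> \<Union>R"
      using R by (meson UnionE UnionI cong_mult cong_refl)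
    with step.IH show ?case by (rule rtrancl_into_rtrancl)
  qed simp
  have right: "(x * s, y * s) \<in> (\<Union>R)\<^sup>*" if "(x, y) \<in> (\<Union>R)\<^sup>*" for s x y
    using that
  proof induction
    case (step y z)
    then have "(y * s, z * s) \<in> \<Union>R"
      using R by (meson UnionE UnionI cong_mult cong_refl)
    with step.IH show ?case by (rule rtrancl_into_rtrancl)
  qed simp
  have "sym (\<Union>R)"
    using R by (meson UnionE UnionI cong_sym symI)
  then have "equiv UNIV ((\<Union>R)\<^sup>*)"
    by (intro equivI refl_rtrancl sym_rtrancl trans_rtrancl) auto
  then show "congruence ((\<Union>R)\<^sup>*)"
    unfolding congruence_def using left right by (meson rtrancl_trans)
qed auto


section \<open>Terms\<close>

lemma term_eval_append:
  "term_vars t \<subseteq> {..<length xs} \<Longrightarrow> term_eval t (xs @ ys) = term_eval t xs"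
  by (induction t) (auto simp: nth_append)

lemma cong_term_eval:
  assumes "congruence \<theta>" and "\<And>i. i \<in> term_vars t \<Longrightarrow> (xs ! i, ys ! i) \<in> \<theta>"
  shows "(term_eval t xs, term_eval t ys) \<in> \<theta>"
  using assms(2) by (induction t) (auto intro: cong_mult[OF assms(1)])

primrec first_var :: "sg_term \<Rightarrow> nat" where
  "first_var (Var i) = i"
| "first_var (Mult s t) = first_var s"

primrec last_var :: "sg_term \<Rightarrow> nat" where
  "last_var (Var i) = i"
| "last_var (Mult s t) = last_var t"

lemma first_var_in_term_vars: "first_var t \<in> term_vars t"
  by (induction t) auto

lemma last_var_in_term_vars: "last_var t \<in> term_vars t"
  by (induction t) auto


section \<open>Completely simple semigroups\<close>

context
  fixes e :: "'a::completely_simple_semigroup"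
  assumes e: "primitive_idempotent e"
begin

lemma e_idem: "e * e = e"
  using e unfolding primitive_idempotent_def by metis

lemma e_primitive: "e * x = x \<Longrightarrow> x * e = x \<Longrightarrow> x * x = x \<Longrightarrow> x = e"
  using e unfolding primitive_idempotent_def by metis

lemma e_e_mult: "e * (e * x) = e * x"
  by (simp add: e_idem flip: mult.assoc)

lemma simple_factorization: "\<exists>p q. y = p * x * q" for x y :: 'a
proof -
  have "is_ideal {p * x * q | p q. True}"
    unfolding is_ideal_def by (auto, (metis mult.assoc)+)
  from simple[OF this] show ?thesis by blast
qed

text \<open>
  Simplicity gives \<open>u(exe)v = e\<close> for some \<open>u, v\<close>, which may be taken in \<open>eSe\<close>. Then
  \<open>(exe)vu\<close> and \<open>vu(exe)\<close> are idempotents of \<open>eSe\<close>, so both equal \<open>e\<close> by primitivity, and \<open>vu\<close> is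
  the inverse of \<open>exe\<close>.
\<close>

lemma ex_corner_inverse: "\<exists>y. e * y = y \<and> y * e = y \<and> y * x * e = e \<and> e * x * y = e"
proof -
  obtain p q where pq: "e = p * (e * x * e) * q"
    using simple_factorization by blast
  define u v a where "u = e * p * e" and "v = e * q * e" and "a = e * x * e"
  have units: "e * u = u" "u * e = u" "e * v = v" "v * e = v" "e * a = a" "a * e = a"
    unfolding u_def v_def a_def by (simp_all add: mult.assoc e_idem e_e_mult)
  have "u * a * v = e * (p * (e * x * e) * q) * e"
    unfolding u_def v_def a_def by (simp add: mult.assoc e_idem e_e_mult)
  then have uav: "u * a * v = e"
    using pq e_idem by simp
  have "a * v * u = e"
  proof (rule e_primitive)
    have "a * v * u * (a * v * u) = a * v * (u * a * v) * u"
      by (simp add: mult.assoc)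
    also have "\<dots> = a * v * u"
      unfolding uav using units by (simp add: mult.assoc)
    finally show "a * v * u * (a * v * u) = a * v * u" .
  qed (use units in \<open>metis mult.assoc\<close>)+
  moreover have "v * u * a = e"
  proof (rule e_primitive)
    have "v * u * a * (v * u * a) = v * (u * a * v) * u * a"
      by (simp add: mult.assoc)
    also have "\<dots> = v * u * a"
      unfolding uav using units by (simp add: mult.assoc)
    finally show "v * u * a * (v * u * a) = v * u * a" .
  qed (use units in \<open>metis mult.assoc\<close>)+
  ultimately show ?thesis
    using units unfolding a_def by (intro exI[of _ "v * u"]) (metis mult.assoc)
qed

definition corner_inverse :: "'a \<Rightarrow> 'a" where
  "corner_inverse x = (SOME y. e * y = y \<and> y * e = y \<and> y * x * e = e \<and> e * x * y = e)"

lemma corner_inverse: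
  shows e_corner_inverse: "e * corner_inverse x = corner_inverse x"
    and corner_inverse_e: "corner_inverse x * e = corner_inverse x"
    and corner_inverse_left: "corner_inverse x * x * e = e"
    and corner_inverse_right: "e * x * corner_inverse x = e"
  unfolding corner_inverse_def using someI_ex[OF ex_corner_inverse[of x]] by blast+

lemma cong_corner_inverse:
  assumes \<theta>: "congruence \<theta>" and xy: "(x, y) \<in> \<theta>"
  shows "(corner_inverse x, corner_inverse y) \<in> \<theta>"
proof -
  have "(corner_inverse x * y * corner_inverse y, corner_inverse x * x * corner_inverse y) \<in> \<theta>"
    using cong_sym[OF \<theta> xy] by (intro cong_mult[OF \<theta>] cong_refl[OF \<theta>])
  moreover have "corner_inverse x * y * corner_inverse y = corner_inverse x"
    by (metis corner_inverse_e corner_inverse_right mult.assoc)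
  moreover have "corner_inverse x * x * corner_inverse y = corner_inverse y"
    by (metis e_corner_inverse corner_inverse_left mult.assoc)
  ultimately show ?thesis by simp
qed

text \<open>
  Green's relations enter through this lemma and its dual: \<open>yx\<close> is always L-related, and \<open>xy\<close>
  always R-related, to \<open>x\<close>. With \<open>x = peq\<close> and \<open>y = res\<close>, the product \<open>p \<iota>(sp) \<iota>(r) y x\<close> collapses to \<open>x\<close>
  because first \<open>\<iota>(r) r e\<close> and then \<open>\<iota>(sp) sp e\<close> become \<open>e\<close>.
\<close>

lemma ex_left_divisor: "\<exists>z. z * y * x = x" for x y :: 'a
proof -
  obtain p q r s where x: "x = p * e * q" and y: "y = r * e * s"
    using simple_factorization by meson
  define z where "z = p * corner_inverse (s * p) * corner_inverse r"
  have "z * y * x = p * corner_inverse (s * p) * (corner_inverse r * r * e) * (s * p) * e * q"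
    unfolding x y z_def by (simp add: mult.assoc)
  also have "\<dots> = p * (corner_inverse (s * p) * e) * (s * p) * e * q"
    unfolding corner_inverse_left by (simp add: mult.assoc)
  also have "\<dots> = p * (corner_inverse (s * p) * (s * p) * e) * q"
    unfolding corner_inverse_e by (simp add: mult.assoc)
  also have "\<dots> = x"
    unfolding x corner_inverse_left ..
  finally show ?thesis by blast
qed

lemma ex_right_divisor: "\<exists>z. x * y * z = x" for x y :: 'a
proof -
  obtain p q r s where x: "x = p * e * q" and y: "y = r * e * s"
    using simple_factorization by meson
  define z where "z = corner_inverse s * corner_inverse (q * r) * q"
  have "x * y * z = p * e * (q * r) * (e * s * corner_inverse s) * corner_inverse (q * r) * q"
    unfolding x y z_def by (simp add: mult.assoc)
  also have "\<dots> = p * e * (q * r) * (e * corner_inverse (q * r)) * q"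
    unfolding corner_inverse_right by (simp add: mult.assoc)
  also have "\<dots> = p * (e * (q * r) * corner_inverse (q * r)) * q"
    unfolding e_corner_inverse by (simp add: mult.assoc)
  also have "\<dots> = x"
    unfolding x corner_inverse_right ..
  finally show ?thesis by blast
qed

text \<open>
  The relation \<open>cs \<delta> ds'\<close> forces \<open>c\<close> and \<open>d\<close> to be R-related modulo \<open>\<delta>\<close>. Hence an element \<open>z\<close> with
  \<open>z e d = d\<close> also satisfies \<open>z e c \<delta> c\<close>, and multiplication by \<open>z\<close> undoes multiplication
  by \<open>e\<close> on both sides.
\<close>

lemma cancel_left:
  assumes \<delta>: "congruence \<delta>"
    and cd: "(c * s, d * s') \<in> \<delta>"
    and ecd: "(e * (c * p), e * (d * q)) \<in> \<delta>"
  shows "(c * p, d * q) \<in> \<delta>"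
proof -
  obtain z where z: "z * e * d = d" using ex_left_divisor by blast
  obtain w where w: "c * s * w = c" using ex_right_divisor by blast
  have "(c * s * w, d * s' * w) \<in> \<delta>"
    by (intro cong_mult[OF \<delta>] cong_refl[OF \<delta>] cd)
  then have c: "(c, d * s' * w) \<in> \<delta>" using w by simp
  then have "(z * e * c, z * e * (d * s' * w)) \<in> \<delta>"
    by (intro cong_mult[OF \<delta>] cong_refl[OF \<delta>])
  also have "z * e * (d * s' * w) = d * s' * w"
    using z by (metis mult.assoc)
  finally have "(c, z * e * c) \<in> \<delta>"
    using c \<delta> by (meson cong_sym cong_trans)
  then have "(c * p, z * e * c * p) \<in> \<delta>"
    by (intro cong_mult[OF \<delta>] cong_refl[OF \<delta>])
  moreover have "(z * (e * (c * p)), z * (e * (d * q))) \<in> \<delta>"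
    by (intro cong_mult[OF \<delta>] cong_refl[OF \<delta>] ecd)
  moreover have "z * (e * (d * q)) = d * q"
    using z by (metis mult.assoc)
  ultimately show ?thesis
    using \<delta> by (metis cong_trans mult.assoc)
qed

lemma cancel_right:
  assumes \<delta>: "congruence \<delta>"
    and cd: "(s * c, s' * d) \<in> \<delta>"
    and cde: "(p * c * e, q * d * e) \<in> \<delta>"
  shows "(p * c, q * d) \<in> \<delta>"
proof -
  obtain z where z: "d * e * z = d" using ex_right_divisor by blast
  obtain w where w: "w * s * c = c" using ex_left_divisor by blast
  have "(w * (s * c), w * (s' * d)) \<in> \<delta>"
    by (intro cong_mult[OF \<delta>] cong_refl[OF \<delta>] cd)
  then have c: "(c, w * (s' * d)) \<in> \<delta>" using w by (simp add: mult.assoc)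
  then have "(c * (e * z), w * (s' * d) * (e * z)) \<in> \<delta>"
    by (intro cong_mult[OF \<delta>] cong_refl[OF \<delta>])
  also have "w * (s' * d) * (e * z) = w * (s' * d)"
    using z by (metis mult.assoc)
  finally have "(c, c * (e * z)) \<in> \<delta>"
    using c \<delta> by (meson cong_sym cong_trans)
  then have "(p * c, p * (c * (e * z))) \<in> \<delta>"
    by (intro cong_mult[OF \<delta>] cong_refl[OF \<delta>])
  moreover have "(p * c * e * z, q * d * e * z) \<in> \<delta>"
    by (intro cong_mult[OF \<delta>] cong_refl[OF \<delta>] cde)
  moreover have "q * d * e * z = q * d"
    using z by (metis mult.assoc)
  ultimately show ?thesis
    using \<delta> by (metis cong_trans mult.assoc)
qed

lemma term_eval_first_var: "\<exists>s. term_eval t xs = xs ! first_var t * s" for xs :: "'a list"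
proof (induction t)
  case (Var i)
  then show ?case using ex_right_divisor by (metis mult.assoc first_var.simps(1) term_eval.simps(1))
qed (auto simp: mult.assoc)

lemma term_eval_last_var: "\<exists>s. term_eval t xs = s * xs ! last_var t" for xs :: "'a list"
proof (induction t)
  case (Var i)
  then show ?case using ex_left_divisor by (metis last_var.simps(1) term_eval.simps(1))
qed (auto simp flip: mult.assoc)


section \<open>The difference condition\<close>

definition difference_related :: "('a \<times> 'a) set \<Rightarrow> ('a \<times> 'a) set \<Rightarrow> 'a list \<Rightarrow> 'a list \<Rightarrow> bool" where
  "difference_related \<alpha> \<delta> cs ds \<longleftrightarrow>
     (\<forall>t a b. term_vars t \<subseteq> {..<length cs + 1} \<longrightarrow> (a, b) \<in> \<alpha> \<longrightarrow>
        (corner_inverse (term_eval t (a # cs)) * term_eval t (b # cs) * e,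
         corner_inverse (term_eval t (a # ds)) * term_eval t (b # ds) * e) \<in> \<delta>)"

lemma difference_related_refl: "congruence \<delta> \<Longrightarrow> difference_related \<alpha> \<delta> cs cs"
  unfolding difference_related_def by (simp add: cong_refl)

lemma difference_related_trans:
  "congruence \<delta> \<Longrightarrow> length bs = length cs \<Longrightarrow>
    difference_related \<alpha> \<delta> bs cs \<Longrightarrow> difference_related \<alpha> \<delta> cs ds \<Longrightarrow> difference_related \<alpha> \<delta> bs ds"
  unfolding difference_related_def by (metis cong_trans)

definition difference_condition :: "('a \<times> 'a) set \<Rightarrow> ('a \<times> 'a) set \<Rightarrow> ('a \<times> 'a) set \<Rightarrow> bool" where
  "difference_condition \<alpha> \<beta> \<delta> \<longleftrightarrow>
     (\<forall>cs ds. list_all2 (\<lambda>c d. (c, d) \<in> \<beta>) cs ds \<longrightarrow> difference_related \<alpha> \<delta> cs ds)"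

lemma difference_condition_mono:
  "difference_condition \<alpha> \<beta> \<delta> \<Longrightarrow> \<delta> \<subseteq> \<delta>' \<Longrightarrow> difference_condition \<alpha> \<beta> \<delta>'"
  unfolding difference_condition_def difference_related_def by blast

lemma difference_condition_antimono:
  "difference_condition \<alpha> \<beta> \<delta> \<Longrightarrow> \<beta>' \<subseteq> \<beta> \<Longrightarrow> difference_condition \<alpha> \<beta>' \<delta>"
  unfolding difference_condition_def by (auto intro: list_all2_mono)

text \<open>
  Tuples that are related coordinatewise by chains of steps are connected by a chain of tuples
  in which every step changes a single coordinate by a pair from a single congruence.
\<close>

lemma difference_condition_rtrancl:
  assumes \<delta>: "congruence \<delta>"
    and R: "\<And>r. r \<in> R \<Longrightarrow> congruence r"
    and D: "\<And>r. r \<in> R \<Longrightarrow> difference_condition \<alpha> r \<delta>"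
  shows "difference_condition \<alpha> ((\<Union>R)\<^sup>*) \<delta>"
proof -
  have one: "difference_related \<alpha> \<delta> (us @ c # vs) (us @ d # vs)"
    if "(c, d) \<in> (\<Union>R)\<^sup>*" for c d us vs
    using that
  proof induction
    case base
    show ?case using difference_related_refl[OF \<delta>] by blast
  next
    case (step y z)
    obtain r where r: "r \<in> R" "(y, z) \<in> r" using step.hyps(2) by blast
    then have "list_all2 (\<lambda>c d. (c, d) \<in> r) (us @ y # vs) (us @ z # vs)"
      using cong_refl[OF R[OF r(1)]] by (simp add: list_all2_append list.rel_refl)
    then have "difference_related \<alpha> \<delta> (us @ y # vs) (us @ z # vs)"
      using D r unfolding difference_condition_def by blast
    then show ?case
      using step.IH difference_related_trans[OF \<delta>, of "us @ c # vs" "us @ y # vs"] by simp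
  qed
  have "difference_related \<alpha> \<delta> (us @ cs) (us @ ds)"
    if "list_all2 (\<lambda>c d. (c, d) \<in> (\<Union>R)\<^sup>*) cs ds" for us cs ds
    using that
  proof (induction arbitrary: us rule: list_all2_induct)
    case Nil
    show ?case by (rule difference_related_refl[OF \<delta>])
  next
    case (Cons c cs d ds)
    show ?case
    proof (rule difference_related_trans[OF \<delta>])
      show "difference_related \<alpha> \<delta> (us @ c # cs) (us @ d # cs)"
        using Cons.hyps by (intro one)
      show "difference_related \<alpha> \<delta> (us @ d # cs) (us @ d # ds)"
        using Cons.IH[of "us @ [d]"] by simp
    qed simp
  qed
  from this[of _ _ "[]"] show ?thesis
    unfolding difference_condition_def by simp
qed

text \<open>
  The terms \<open>v \<cdot> t \<cdot> w\<close> with two additional parameters \<open>v\<close> and \<open>w\<close>, the second one constantly \<open>e\<close>,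
  normalize the value at \<open>a\<close> to \<open>e\<close>.
\<close>

lemma difference_condition_if_centralizes:
  assumes \<beta>: "congruence \<beta>" and \<delta>: "congruence \<delta>"
    and C: "centralizes \<alpha> \<beta> \<delta>"
  shows "difference_condition \<alpha> \<beta> \<delta>"
  unfolding difference_condition_def difference_related_def
proof (intro allI impI)
  fix cs ds t a b
  assume cd: "list_all2 (\<lambda>c d. (c, d) \<in> \<beta>) cs ds" and t: "term_vars t \<subseteq> {..<length cs + 1}"
    and ab: "(a, b) \<in> \<alpha>"
  have len: "length ds = length cs" using cd by (simp add: list_all2_lengthD)
  define n where "n = length cs"
  define T where "T = Mult (Mult (Var (n + 1)) t) (Var (n + 2))"
  define v where "v = (\<lambda>xs. corner_inverse (term_eval t (a # xs)))"
  have T: "term_eval T (x # xs @ [v xs, e]) = v xs * term_eval t (x # xs) * e"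
    if "length xs = n" for x xs
    using that t term_eval_append[of t "x # xs" "[v xs, e]"]
    unfolding T_def by (simp add: nth_append n_def)
  have at_a: "term_eval T (a # xs @ [v xs, e]) = e" if "length xs = n" for xs
    using T[OF that, of a] corner_inverse_left unfolding v_def by simp
  have nth: "(cs ! i, ds ! i) \<in> \<beta>" if "i < n" for i
    using list_all2_nthD[OF cd] that by (simp add: n_def)
  have "(term_eval t (a # cs), term_eval t (a # ds)) \<in> \<beta>"
  proof (rule cong_term_eval[OF \<beta>])
    fix i assume "i \<in> term_vars t"
    then show "((a # cs) ! i, (a # ds) ! i) \<in> \<beta>"
      using t nth by (cases i) (auto simp: n_def cong_refl[OF \<beta>])
  qed
  then have vv: "(v cs, v ds) \<in> \<beta>"
    unfolding v_def by (rule cong_corner_inverse[OF \<beta>])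
  have params: "((cs @ [v cs, e]) ! i, (ds @ [v ds, e]) ! i) \<in> \<beta>" if "i < n + 2" for i
  proof -
    have "i < n \<or> i = n \<or> i = n + 1" using that by arith
    then consider "i < n" | "i = n" | "i = n + 1" by blast
    then show ?thesis
      by cases (auto simp: nth_append len nth vv cong_refl[OF \<beta>] simp flip: n_def)
  qed
  have "(term_eval T (b # cs @ [v cs, e]), term_eval T (b # ds @ [v ds, e])) \<in> \<delta>"
  proof (rule C[unfolded centralizes_def, rule_format, of "n + 2"])
    show "term_vars T \<subseteq> {..<n + 2 + 1}"
      using t unfolding T_def n_def by auto
    show "(term_eval T (a # cs @ [v cs, e]), term_eval T (a # ds @ [v ds, e])) \<in> \<delta>"
      by (simp add: at_a len n_def cong_refl[OF \<delta>])
  qed (use ab params len in \<open>auto simp: n_def\<close>)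
  then show "(corner_inverse (term_eval t (a # cs)) * term_eval t (b # cs) * e,
      corner_inverse (term_eval t (a # ds)) * term_eval t (b # ds) * e) \<in> \<delta>"
    using T len unfolding v_def n_def by simp
qed

text \<open>
  If the values at \<open>a\<close> agree modulo \<open>\<delta>\<close>, then multiplying the two congruent quotients by them from
  the left makes the values at \<open>b\<close> agree between two factors \<open>e\<close>. The first and last
  letters provide what the cancellation lemmas need: where such a letter is the distinguished
  variable, the two sides have the same letter; otherwise the agreement at \<open>a\<close> relates the two
  letters.
\<close>

lemma centralizes_if_difference_condition:
  assumes \<delta>: "congruence \<delta>" and D: "difference_condition \<alpha> \<beta> \<delta>"
  shows "centralizes \<alpha> \<beta> \<delta>"
  unfolding centralizes_def
proof (intro allI impI)
  fix n t a b and cs ds :: "'a list"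
  assume t: "term_vars t \<subseteq> {..<n + 1}" and len: "length cs = n" "length ds = n"
    and ab: "(a, b) \<in> \<alpha>" and cd: "\<forall>i<n. (cs ! i, ds ! i) \<in> \<beta>"
    and ta: "(term_eval t (a # cs), term_eval t (a # ds)) \<in> \<delta>"
  let ?A = "term_eval t (a # cs)" and ?B = "term_eval t (a # ds)"
  let ?P = "term_eval t (b # cs)" and ?Q = "term_eval t (b # ds)"
  have "list_all2 (\<lambda>c d. (c, d) \<in> \<beta>) cs ds"
    using len cd by (simp add: list_all2_conv_all_nth)
  then have "(corner_inverse ?A * ?P * e, corner_inverse ?B * ?Q * e) \<in> \<delta>"
    using D t ab len unfolding difference_condition_def difference_related_def by simp
  then have "(e * ?A * (corner_inverse ?A * ?P * e), e * ?B * (corner_inverse ?B * ?Q * e)) \<in> \<delta>"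
    by (rule cong_mult[OF \<delta> cong_mult[OF \<delta> cong_refl[OF \<delta>] ta]])
  then have ePe: "(e * ?P * e, e * ?Q * e) \<in> \<delta>"
    by (simp add: corner_inverse_right flip: mult.assoc)

  define i where "i = first_var t"
  have i: "i < n + 1"
    using t first_var_in_term_vars unfolding i_def by blast
  obtain p q where p: "?P = (b # cs) ! i * p" and q: "?Q = (b # ds) ! i * q"
    unfolding i_def using term_eval_first_var by meson
  have "\<exists>s s'. ((b # cs) ! i * s, (b # ds) ! i * s') \<in> \<delta>"
  proof (cases i)
    case 0
    then show ?thesis using cong_refl[OF \<delta>] by auto
  next
    case (Suc j)
    obtain s s' where "?A = (a # cs) ! i * s" "?B = (a # ds) ! i * s'"
      unfolding i_def using term_eval_first_var by meson
    then show ?thesis using ta Suc by auto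
  qed
  then obtain s s' where "((b # cs) ! i * s, (b # ds) ! i * s') \<in> \<delta>" by blast
  from cancel_left[OF \<delta> this, of "p * e" "q * e"] have Pe: "(?P * e, ?Q * e) \<in> \<delta>"
    using ePe p q by (simp add: mult.assoc)

  define j where "j = last_var t"
  have j: "j < n + 1"
    using t last_var_in_term_vars unfolding j_def by blast
  obtain p' q' where p': "?P = p' * (b # cs) ! j" and q': "?Q = q' * (b # ds) ! j"
    unfolding j_def using term_eval_last_var by meson
  have "\<exists>s s'. (s * (b # cs) ! j, s' * (b # ds) ! j) \<in> \<delta>"
  proof (cases j)
    case 0
    then show ?thesis using cong_refl[OF \<delta>] by auto
  next
    case (Suc k)
    obtain s s' where "?A = s * (a # cs) ! j" "?B = s' * (a # ds) ! j"
      unfolding j_def using term_eval_last_var by meson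
    then show ?thesis using ta Suc by auto
  qed
  then obtain s s' where "(s * (b # cs) ! j, s' * (b # ds) ! j) \<in> \<delta>" by blast
  from cancel_right[OF \<delta> this, of p' q'] show "(?P, ?Q) \<in> \<delta>"
    using Pe p' q' by simp
qed

end


section \<open>Distributivity of the commutator over joins\<close>

theorem proposition5p5:
  fixes \<rho> :: "('a::completely_simple_semigroup \<times> 'a) set"
    and \<sigma> :: "'k \<Rightarrow> ('a \<times> 'a) set"
    and K :: "'k set"
  assumes "congruence \<rho>"
    and "\<And>k. k \<in> K \<Longrightarrow> congruence (\<sigma> k)"
  shows "commutator \<rho> (cong_join (\<sigma> ` K)) = cong_join ((\<lambda>k. commutator \<rho> (\<sigma> k)) ` K)"
    (is "_ = ?\<delta>")
proof
  obtain e :: 'a where e: "primitive_idempotent e"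
    using ex_primitive_idempotent by blast
  have \<delta>: "congruence ?\<delta>" by (rule congruence_cong_join)
  have "difference_condition e \<rho> (\<sigma> k) ?\<delta>" if k: "k \<in> K" for k
  proof (rule difference_condition_mono[OF e])
    show "difference_condition e \<rho> (\<sigma> k) (commutator \<rho> (\<sigma> k))"
      using assms k by (intro difference_condition_if_centralizes[OF e] congruence_commutator
          centralizes_commutator)
    show "commutator \<rho> (\<sigma> k) \<subseteq> ?\<delta>"
      using k by (intro cong_join_upper) blast
  qed
  then have "difference_condition e \<rho> ((\<Union>(\<sigma> ` K))\<^sup>*) ?\<delta>"
    using assms(2) by (intro difference_condition_rtrancl[OF e \<delta>]) auto
  moreover have "cong_join (\<sigma> ` K) \<subseteq> (\<Union>(\<sigma> ` K))\<^sup>*"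
    using assms(2) by (intro cong_join_subset_rtrancl) auto
  ultimately have "difference_condition e \<rho> (cong_join (\<sigma> ` K)) ?\<delta>"
    by (rule difference_condition_antimono[OF e])
  then have "centralizes \<rho> (cong_join (\<sigma> ` K)) ?\<delta>"
    by (rule centralizes_if_difference_condition[OF e \<delta>])
  with \<delta> show "commutator \<rho> (cong_join (\<sigma> ` K)) \<subseteq> ?\<delta>"
    by (rule commutator_least)
  show "?\<delta> \<subseteq> commutator \<rho> (cong_join (\<sigma> ` K))"
  proof (rule cong_join_least[OF congruence_commutator])
    fix r assume "r \<in> (\<lambda>k. commutator \<rho> (\<sigma> k)) ` K"
    then obtain k where k: "k \<in> K" and r: "r = commutator \<rho> (\<sigma> k)" by blast
    from k show "r \<subseteq> commutator \<rho> (cong_join (\<sigma> ` K))"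
      unfolding r by (rule commutator_mono[OF cong_join_upper[OF imageI]])
  qed
qed

end
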